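(* If $G$ is a connected graph with at least two vertices, then $$\mathrm{def}_c(\widehat{G})\ge \frac{|E(G)|-1}{4(\mathrm{diam}(G)+2)}-\Delta(G)+1.$$
   Context: All graphs are finite, simple and undirected. For a graph $G$ with $V(G)=\{v_1,\dots,v_n\}$, $S(G)$ is the graph obtained by subdividing every edge: $V(S(G))=V(G)\cup\{w_{ij}:v_iv_j\in E(G)\}$ and $E(S(G))=\{v_iw_{ij},v_jw_{ij}:v_iv_j\in E(G)\}$. The graph $\widehat{G}$ is obtained from $S(G)$ by adding a new vertex $u$ and the edges $uw_{ij}$ for all $v_iv_j\in E(G)$. $\mathrm{diam}(G)$ is the diameter and $\Delta(G)$ the maximum degree. A set $A\subseteq\{1,\dots,t\}$ is a cyclic interval modulo $t$ if $A$ or $\{1,\dots,t\}\setminus A$ is an interval of integers; a cyclic interval $t$-coloring is a proper edge coloring with colors $1,\dots,t$ in which the set of colors at every vertex is a cyclic interval modulo $t$. The cyclic deficiency $\mathrm{def}_c(H)$ of a graph $H$ is the minimum number of pendant edges whose attachment to $H$ yields a graph admitting a cyclic interval coloring (equivalently, the minimum over proper edge colorings $\alpha$ of $H$, with any number $t$ of colors, of the sum over vertices $v$ of the minimum number of positive integers that must be added to the color set at $v$ to make it a cyclic interval modulo $t$). *)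

theory Defs
  imports Complex_Main
begin

record 'v ugraph =
  verts :: "'v set"
  edges :: "'v set set"

definition simple_graph :: "'v ugraph \<Rightarrow> bool" where
  "simple_graph G \<longleftrightarrow>
     finite (verts G) \<and> (\<forall>e\<in>edges G. e \<subseteq> verts G \<and> card e = 2)"

definition incident :: "'v ugraph \<Rightarrow> 'v \<Rightarrow> 'v set set" where
  "incident G v = {e \<in> edges G. v \<in> e}"

definition degree :: "'v ugraph \<Rightarrow> 'v \<Rightarrow> nat" where
  "degree G v = card (incident G v)"

definition max_degree :: "'v ugraph \<Rightarrow> nat" where
  "max_degree G = Max (degree G ` verts G)"

definition walk :: "'v ugraph \<Rightarrow> 'v \<Rightarrow> 'v list \<Rightarrow> 'v \<Rightarrow> bool" where
  "walk G x p y \<longleftrightarrow>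
     p \<noteq> [] \<and> hd p = x \<and> last p = y \<and> set p \<subseteq> verts G \<and>
     successively (\<lambda>a b. {a, b} \<in> edges G) p"

definition connected_graph :: "'v ugraph \<Rightarrow> bool" where
  "connected_graph G \<longleftrightarrow>
     verts G \<noteq> {} \<and> (\<forall>x\<in>verts G. \<forall>y\<in>verts G. \<exists>p. walk G x p y)"

text \<open>Distance counts edges, so a walk with \<open>n + 1\<close> vertices has length \<open>n\<close>.
  Distance and diameter are meaningful for connected graphs only.\<close>

definition graph_dist :: "'v ugraph \<Rightarrow> 'v \<Rightarrow> 'v \<Rightarrow> nat" where
  "graph_dist G x y = (LEAST n. \<exists>p. walk G x p y \<and> length p = Suc n)"

definition diam :: "'v ugraph \<Rightarrow> nat" where
  "diam G = Max {graph_dist G x y | x y. x \<in> verts G \<and> y \<in> verts G}"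

text \<open>The vertex \<open>w\<^sub>i\<^sub>j\<close> subdividing the edge \<open>e = v\<^sub>iv\<^sub>j\<close> is \<open>Mid e\<close>; the additional
  vertex \<open>u\<close> is \<open>Apex\<close>.\<close>

datatype 'v hat_vertex = Orig 'v | Mid "'v set" | Apex

definition subdivision :: "'v ugraph \<Rightarrow> 'v hat_vertex ugraph" where
  "subdivision G =
     \<lparr>verts = Orig ` verts G \<union> Mid ` edges G,
      edges = {{Orig v, Mid e} | v e. e \<in> edges G \<and> v \<in> e}\<rparr>"

definition hat :: "'v ugraph \<Rightarrow> 'v hat_vertex ugraph" where
  "hat G =
     \<lparr>verts = insert Apex (verts (subdivision G)),
      edges = edges (subdivision G) \<union> {{Apex, Mid e} | e. e \<in> edges G}\<rparr>"

text \<open>The empty set counts as an interval. In a coloring with colors \<open>1, \<dots>, t\<close> it is not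
  required that every color occurs.\<close>

definition int_interval :: "nat set \<Rightarrow> bool" where
  "int_interval A \<longleftrightarrow> (\<exists>a b. A = {a..b})"

definition cyclic_interval :: "nat \<Rightarrow> nat set \<Rightarrow> bool" where
  "cyclic_interval t A \<longleftrightarrow>
     A \<subseteq> {1..t} \<and> (int_interval A \<or> int_interval ({1..t} - A))"

definition proper_edge_coloring :: "'v ugraph \<Rightarrow> nat \<Rightarrow> ('v set \<Rightarrow> nat) \<Rightarrow> bool" where
  "proper_edge_coloring G t \<alpha> \<longleftrightarrow>
     \<alpha> ` edges G \<subseteq> {1..t} \<and>
     (\<forall>e\<in>edges G. \<forall>f\<in>edges G. e \<noteq> f \<and> e \<inter> f \<noteq> {} \<longrightarrow> \<alpha> e \<noteq> \<alpha> f)"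

definition cyclic_interval_coloring :: "'v ugraph \<Rightarrow> nat \<Rightarrow> ('v set \<Rightarrow> nat) \<Rightarrow> bool" where
  "cyclic_interval_coloring G t \<alpha> \<longleftrightarrow>
     proper_edge_coloring G t \<alpha> \<and>
     (\<forall>v\<in>verts G. cyclic_interval t (\<alpha> ` incident G v))"

definition cyclically_interval_colorable :: "'v ugraph \<Rightarrow> bool" where
  "cyclically_interval_colorable G \<longleftrightarrow> (\<exists>t \<alpha>. cyclic_interval_coloring G t \<alpha>)"

text \<open>\<open>attach_pendants G p\<close> attaches \<open>p v\<close> pendant edges to each vertex \<open>v\<close> of \<open>G\<close>, with
  new leaves \<open>Inr (v, i)\<close> for \<open>i < p v\<close>.\<close>

definition attach_pendants :: "'v ugraph \<Rightarrow> ('v \<Rightarrow> nat) \<Rightarrow> ('v + 'v \<times> nat) ugraph" where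
  "attach_pendants G p =
     \<lparr>verts = Inl ` verts G \<union> Inr ` (SIGMA v:verts G. {..<p v}),
      edges = (`) Inl ` edges G \<union> {{Inl v, Inr (v, i)} | v i. v \<in> verts G \<and> i < p v}\<rparr>"

definition cyclic_deficiency :: "'v ugraph \<Rightarrow> nat" where
  "cyclic_deficiency G =
     (LEAST k. \<exists>p. (\<Sum>v\<in>verts G. p v) = k \<and>
        cyclically_interval_colorable (attach_pendants G p))"

text \<open>The hat of a simple graph is simple, and for simple graphs the minimum defining the
  cyclic deficiency ranges over a nonempty set.\<close>

lemma simple_graph_finite_edges:
  assumes "simple_graph G"
  shows "finite (edges G)"
proof (rule finite_subset)
  show "edges G \<subseteq> Pow (verts G)" using assms by (auto simp: simple_graph_def)
  show "finite (Pow (verts G))" using assms by (auto simp: simple_graph_def)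
qed

lemma simple_graph_hat:
  assumes "simple_graph G"
  shows "simple_graph (hat G)"
proof -
  have "finite (edges G)" using assms by (rule simple_graph_finite_edges)
  then show ?thesis
    using assms by (fastforce simp: simple_graph_def hat_def subdivision_def)
qed

lemma ex_pendants_colorable:
  assumes "simple_graph G"
  shows "\<exists>p. cyclically_interval_colorable (attach_pendants G p)"
proof -
  define t where "t = card (edges G)"
  have fin: "finite (edges G)" using assms by (rule simple_graph_finite_edges)
  obtain \<alpha> where \<alpha>: "bij_betw \<alpha> (edges G) {1..t}"
    using ex_bij_betw_finite_nat[OF fin] fin
    by (metis t_def bij_betw_iff_card card_atLeastAtMost diff_Suc_1 finite_atLeastAtMost One_nat_def)
  define M where "M v = {1..t} - \<alpha> ` incident G v" for v
  define p where "p v = card (M v)" for v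
  have "\<exists>g. bij_betw g {..<p v} (M v)" for v
    by (rule finite_same_card_bij) (auto simp: p_def M_def)
  then obtain \<beta> where \<beta>: "\<And>v. bij_betw (\<beta> v) {..<p v} (M v)" by metis
  define \<gamma> where "\<gamma> e = (if \<exists>v i. e = {Inl v, Inr (v, i)}
      then (case SOME x. e = {Inl (fst x), Inr x} of (v, i) \<Rightarrow> \<beta> v i) else \<alpha> (Inl -` e))"
    for e :: "('a + 'a \<times> nat) set"
  have g1: "\<gamma> (Inl ` e) = \<alpha> e" for e
  proof -
    have "Inl -` (Inl ` e :: ('a + 'a \<times> nat) set) = e" by (rule inj_vimage_image_eq) simp
    moreover have "Inl ` e \<noteq> {Inl v, Inr (v, i)}" for v and i :: nat by blast
    ultimately show ?thesis by (simp add: \<gamma>_def)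
  qed
  have g2: "\<gamma> {Inl v, Inr (v, i)} = \<beta> v i" for v i
  proof -
    have "(SOME x. {Inl v, Inr (v, i)} = {Inl (fst x), Inr x}) = (v, i)"
      by (rule some_equality) (auto simp: doubleton_eq_iff)
    then show ?thesis by (auto simp: \<gamma>_def)
  qed
  let ?H = "attach_pendants G p"
  have in_l: "Inl v \<in> Inl ` e \<longleftrightarrow> v \<in> e" for v :: 'a and e by auto
  have inc: "incident ?H (Inl v) =
      (`) Inl ` incident G v \<union> (\<lambda>i. {Inl v, Inr (v, i)}) ` {..<p v}" if "v \<in> verts G" for v
    using that by (auto simp: incident_def attach_pendants_def)
  have inc': "incident ?H (Inr (v, i)) = {{Inl v, Inr (v, i)}}"
    if "v \<in> verts G" "i < p v" for v i
    using that by (auto simp: incident_def attach_pendants_def)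
  have \<alpha>_range: "\<alpha> e \<in> {1..t}" if "e \<in> edges G" for e
    using \<alpha> that by (auto simp: bij_betw_def)
  have \<beta>_range: "\<beta> v i \<in> M v" if "i < p v" for v i
    using \<beta>[of v] that by (auto simp: bij_betw_def)
  have \<alpha>_inj: "\<alpha> e = \<alpha> f \<longleftrightarrow> e = f" if "e \<in> edges G" "f \<in> edges G" for e f
    using \<alpha> that by (auto simp: bij_betw_def inj_on_def)
  have \<beta>_inj: "\<beta> v i = \<beta> v j \<longleftrightarrow> i = j" if "i < p v" "j < p v" for v i j
    using \<beta>[of v] that by (auto simp: bij_betw_def inj_on_def)
  have \<alpha>\<beta>: "\<alpha> e \<noteq> \<beta> v i" if "e \<in> edges G" "v \<in> e" "i < p v" for e v i
    using \<beta>_range[of i v] that by (force simp: M_def incident_def)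
  have full: "\<gamma> ` incident ?H (Inl v) = {1..t}" if "v \<in> verts G" for v
  proof -
    have "\<gamma> ` incident ?H (Inl v) = \<alpha> ` incident G v \<union> \<beta> v ` {..<p v}"
      by (simp add: inc[OF that] image_Un image_image g1 g2)
    also have "\<dots> = \<alpha> ` incident G v \<union> M v" using \<beta>[of v] by (simp add: bij_betw_def)
    also have "\<dots> = {1..t}" using \<alpha>_range by (auto simp: M_def incident_def)
    finally show ?thesis .
  qed
  have edge: "(\<exists>e'\<in>edges G. h = Inl ` e') \<or> (\<exists>v i. i < p v \<and> h = {Inl v, Inr (v, i)})"
    if "h \<in> edges ?H" for h
    using that unfolding attach_pendants_def by auto
  have "proper_edge_coloring ?H t \<gamma>"
    unfolding proper_edge_coloring_def
  proof (intro conjI ballI impI)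
    have "\<gamma> h \<in> {1..t}" if "h \<in> edges ?H" for h
      using edge[OF that]
    proof (elim disjE bexE exE conjE)
      fix e' assume "e' \<in> edges G" "h = Inl ` e'"
      then show ?thesis using \<alpha>_range[of e'] by (simp only: g1)
    next
      fix v i assume "i < p v" "h = {Inl v, Inr (v, i)}"
      then show ?thesis using \<beta>_range[of i v] by (simp only: g2 M_def Diff_iff)
    qed
    then show "\<gamma> ` edges ?H \<subseteq> {1..t}" by (rule image_subsetI)
  next
    fix e f assume "e \<in> edges ?H" "f \<in> edges ?H" and ef: "e \<noteq> f \<and> e \<inter> f \<noteq> {}"
    from edge[OF \<open>e \<in> edges ?H\<close>] edge[OF \<open>f \<in> edges ?H\<close>] consider
        (a) e' f' where "e = Inl ` e'" "f = Inl ` f'" "e' \<in> edges G" "f' \<in> edges G"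
      | (b) e' v i where "e = Inl ` e'" "f = {Inl v, Inr (v, i)}" "e' \<in> edges G" "i < p v"
      | (c) f' v i where "f = Inl ` f'" "e = {Inl v, Inr (v, i)}" "f' \<in> edges G" "i < p v"
      | (d) v i w j where "e = {Inl v, Inr (v, i)}" "f = {Inl w, Inr (w, j)}" "i < p v" "j < p w"
      by metis
    then show "\<gamma> e \<noteq> \<gamma> f"
    proof cases
      case a then show ?thesis using ef by (auto simp: g1 \<alpha>_inj)
    next
      case b then show ?thesis using ef \<alpha>\<beta>[of e' v i] by (auto simp: g1 g2)
    next
      case c then show ?thesis using ef \<alpha>\<beta>[of f' v i] by (auto simp: g1 g2)
    next
      case d then show ?thesis using ef by (auto simp: g2 \<beta>_inj)
    qed
  qed
  moreover have "cyclic_interval t (\<gamma> ` incident ?H x)" if x: "x \<in> verts ?H" for x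
  proof -
    consider (a) v where "x = Inl v" "v \<in> verts G"
      | (b) v i where "x = Inr (v, i)" "v \<in> verts G" "i < p v"
      using x by (auto simp: attach_pendants_def)
    then show ?thesis
    proof cases
      case a
      then show ?thesis by (auto simp: full cyclic_interval_def int_interval_def)
    next
      case b
      then have "\<gamma> ` incident ?H x = {\<beta> v i..\<beta> v i}" by (simp add: inc' g2)
      moreover have "{\<beta> v i..\<beta> v i} \<subseteq> {1..t}"
        using \<beta>_range[of i v] b by (simp add: M_def)
      ultimately show ?thesis unfolding cyclic_interval_def int_interval_def by metis
    qed
  qed
  ultimately show ?thesis
    unfolding cyclically_interval_colorable_def cyclic_interval_coloring_def by blast
qed

lemma cyclic_deficiency_attained:
  assumes "simple_graph G"
  shows "\<exists>p. (\<Sum>v\<in>verts G. p v) = cyclic_deficiency G \<and>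
           cyclically_interval_colorable (attach_pendants G p)"
  unfolding cyclic_deficiency_def
  by (rule LeastI_ex) (use ex_pendants_colorable[OF assms] in blast)

end

theory Submission
  imports Defs
begin

text \<open>
  Let \<open>K\<close> be the cyclic deficiency, \<open>D\<close> the diameter and \<open>\<Delta>\<close> the maximum degree of \<open>G\<close>.
  In an optimal coloring, two colors at a vertex of degree \<open>d\<close> (pendant edges
  included) differ by at most \<open>d - 1\<close> modulo \<open>t\<close>.
  If \<open>\<Delta> \<ge> 3\<close>, this difference is at most \<open>K + \<Delta> - 1\<close> at every vertex other than the apex.
  Two edges at the apex are joined by a path of the subdivision with at most \<open>2D + 3\<close> inner
  vertices, so the \<open>|E(G)|\<close> distinct colors at the apex lie within cyclic distance
  \<open>(2D + 3)(K + \<Delta> - 1)\<close> of one of them, and there are at most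
  \<open>2(2D + 3)(K + \<Delta> - 1) + 1\<close> such colors. If \<open>\<Delta> \<le> 2\<close>, the bound already follows from counting the
  edges of \<open>G\<close> layer by layer around a vertex.
\<close>

section \<open>Distance and degree\<close>

lemma walk_snoc:
  assumes "walk G x p y" "{y, z} \<in> edges G" "z \<in> verts G"
  shows "walk G x (p @ [z]) z"
  using assms by (auto simp: walk_def successively_append_iff)

lemma walk_Nil_iff: "walk G x [v] y \<longleftrightarrow> v = x \<and> v = y \<and> x \<in> verts G"
  by (auto simp: walk_def)

lemma walk_snocD:
  assumes "walk G x (p @ [z]) y" "p \<noteq> []"
  shows "z = y" "walk G x p (last p)" "{last p, y} \<in> edges G"
  using assms by (auto simp: walk_def successively_append_iff)

lemma graph_dist_le:
  assumes "walk G x p y" "length p = Suc n"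
  shows "graph_dist G x y \<le> n"
  unfolding graph_dist_def by (rule Least_le) (use assms in blast)

lemma graph_dist_walk:
  assumes "connected_graph G" "x \<in> verts G" "y \<in> verts G"
  obtains p where "walk G x p y" "length p = Suc (graph_dist G x y)"
proof -
  obtain p where "walk G x p y" using assms by (auto simp: connected_graph_def)
  moreover then have "length p = Suc (length p - 1)" by (cases p) (auto simp: walk_def)
  ultimately have "\<exists>n p. walk G x p y \<and> length p = Suc n" by blast
  then have "\<exists>p. walk G x p y \<and> length p = Suc (graph_dist G x y)"
    unfolding graph_dist_def by (rule LeastI_ex)
  then show thesis using that by blast
qed

lemma graph_dist_eq_0_iff:
  assumes "connected_graph G" "x \<in> verts G" "y \<in> verts G"
  shows "graph_dist G x y = 0 \<longleftrightarrow> x = y"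
proof
  assume "graph_dist G x y = 0"
  then obtain p where "walk G x p y" "length p = Suc 0" using graph_dist_walk[OF assms] by metis
  then show "x = y" by (auto simp: length_Suc_conv walk_Nil_iff)
next
  assume "x = y"
  then show "graph_dist G x y = 0"
    using graph_dist_le[of G x "[x]" y 0] assms by (simp add: walk_Nil_iff)
qed

lemma graph_dist_edge_le:
  assumes "connected_graph G" "x \<in> verts G" "y \<in> verts G" "z \<in> verts G" "{y, z} \<in> edges G"
  shows "graph_dist G x z \<le> Suc (graph_dist G x y)"
proof -
  obtain p where "walk G x p y" "length p = Suc (graph_dist G x y)"
    using graph_dist_walk assms by metis
  then show ?thesis using graph_dist_le[OF walk_snoc[of G x p y z]] assms by simp
qed

text \<open>The vertex before the last on a shortest walk works: dropping the last step bounds its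
  distance by \<open>k\<close> from above, and the edge to \<open>y\<close> bounds it from
  below.\<close>

lemma graph_dist_pred:
  assumes "connected_graph G" "x \<in> verts G" "y \<in> verts G" "graph_dist G x y = Suc k"
  obtains z where "z \<in> verts G" "{z, y} \<in> edges G" "graph_dist G x z = k"
proof -
  obtain p where p: "walk G x p y" "length p = Suc (Suc k)"
    using graph_dist_walk assms by metis
  then obtain q w where q: "p = q @ [w]" "length q = Suc k" by (auto simp: length_Suc_conv_rev)
  then have "q \<noteq> []" by auto
  then have w: "walk G x q (last q)" "{last q, y} \<in> edges G"
    using walk_snocD p(1) q(1) by metis+
  have v: "last q \<in> verts G" using w(1) by (auto simp: walk_def)
  have "graph_dist G x (last q) \<le> k" using graph_dist_le w(1) q(2) by metis
  moreover have "Suc k \<le> Suc (graph_dist G x (last q))"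
    using graph_dist_edge_le[OF assms(1,2) v assms(3) w(2)] assms(4) by simp
  ultimately show thesis using that[OF v w(2)] by simp
qed

lemma graph_dist_le_diam:
  assumes "simple_graph G" "x \<in> verts G" "y \<in> verts G"
  shows "graph_dist G x y \<le> diam G"
proof -
  have "{graph_dist G x y | x y. x \<in> verts G \<and> y \<in> verts G}
      = (\<lambda>(x, y). graph_dist G x y) ` (verts G \<times> verts G)" by auto
  then have "finite {graph_dist G x y | x y. x \<in> verts G \<and> y \<in> verts G}"
    using assms by (simp add: simple_graph_def)
  then show ?thesis unfolding diam_def by (rule Max_ge) (use assms in blast)
qed

lemma degree_le_max_degree:
  assumes "simple_graph G" "v \<in> verts G"
  shows "degree G v \<le> max_degree G"
  unfolding max_degree_def by (rule Max_ge) (use assms in \<open>auto simp: simple_graph_def\<close>)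

lemma finite_incident:
  assumes "simple_graph G"
  shows "finite (incident G v)"
  using simple_graph_finite_edges[OF assms] by (simp add: incident_def)

lemma simple_graph_edgeE:
  assumes "simple_graph G" "e \<in> edges G" "v \<in> e"
  obtains w where "e = {v, w}" "w \<noteq> v" "v \<in> verts G" "w \<in> verts G"
proof -
  have e: "card e = 2" "e \<subseteq> verts G" using assms by (auto simp: simple_graph_def)
  then obtain a b where "e = {a, b}" "a \<noteq> b" by (auto simp: card_2_iff)
  then show thesis using that assms(3) e(2) by (cases "v = a") auto
qed

text \<open>Ensures that the truncated subtraction of 1 from a sum containing
  \<open>max_degree G\<close> is a genuine subtraction in the final bound.\<close>

lemma max_degree_pos:
  assumes "simple_graph G" "connected_graph G" "card (verts G) \<ge> 2"
  shows "max_degree G \<ge> 1"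
proof -
  have "\<not> card (verts G) \<le> Suc 0" using assms(3) by simp
  then obtain x y where xy: "x \<in> verts G" "y \<in> verts G" "x \<noteq> y"
    using card_le_Suc0_iff_eq assms(1) unfolding simple_graph_def by metis
  then obtain k where "graph_dist G x y = Suc k"
    using graph_dist_eq_0_iff assms(2) not0_implies_Suc by metis
  then obtain z where "{z, y} \<in> edges G" using graph_dist_pred assms(2) xy by metis
  then have "incident G y \<noteq> {}" by (auto simp: incident_def)
  then have "degree G y \<ge> 1"
    using finite_incident[OF assms(1)] by (simp add: degree_def Suc_leI card_gt_0_iff)
  then show ?thesis using degree_le_max_degree[OF assms(1) xy(2)] by simp
qed

section \<open>Counting edges by distance\<close>

text \<open>The index is the smaller of the two endpoint distances, so edges inside a sphere and
  edges leaving it outwards share a layer.\<close>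

definition edge_layer :: "'v ugraph \<Rightarrow> 'v \<Rightarrow> nat \<Rightarrow> 'v set set" where
  "edge_layer G x k =
     {e \<in> edges G. (\<forall>v\<in>e. k \<le> graph_dist G x v) \<and> (\<exists>v\<in>e. graph_dist G x v = k)}"

lemma finite_edge_layer:
  assumes "simple_graph G"
  shows "finite (edge_layer G x k)"
  using simple_graph_finite_edges[OF assms] by (simp add: edge_layer_def)

lemma card_edge_layer_0:
  assumes "simple_graph G" "connected_graph G" "x \<in> verts G"
  shows "card (edge_layer G x 0) \<le> max_degree G"
proof -
  have "edge_layer G x 0 \<subseteq> incident G x"
  proof
    fix e assume "e \<in> edge_layer G x 0"
    then obtain v where v: "e \<in> edges G" "v \<in> e" "graph_dist G x v = 0"
      by (auto simp: edge_layer_def)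
    then have "v \<in> verts G" using assms(1) by (auto simp: simple_graph_def)
    then show "e \<in> incident G x"
      using v graph_dist_eq_0_iff[OF assms(2,3)] by (auto simp: incident_def)
  qed
  then have "card (edge_layer G x 0) \<le> degree G x"
    unfolding degree_def using finite_incident[OF assms(1)] card_mono by blast
  then show ?thesis using degree_le_max_degree[OF assms(1,3)] by simp
qed

text \<open>A vertex at distance \<open>k + 1\<close> has an edge to a vertex at distance
  \<open>k\<close>, so every edge of the outer layer meets an edge of the inner one. Conversely an
  inner edge meets few outer edges, since all of them must pass through one of its two ends.\<close>

lemma card_edge_layer_Suc:
  assumes "simple_graph G" "connected_graph G" "x \<in> verts G"
  shows "card (edge_layer G x (Suc k)) \<le> card (edge_layer G x k) * (max_degree G - 1)"
proof -
  define N where "N f = {e \<in> edge_layer G x (Suc k). e \<inter> f \<noteq> {}}" for f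
  have "\<exists>f\<in>edge_layer G x k. e \<inter> f \<noteq> {}" if e: "e \<in> edge_layer G x (Suc k)" for e
  proof -
    obtain y where y: "y \<in> e" "graph_dist G x y = Suc k" "e \<in> edges G"
      using e by (auto simp: edge_layer_def)
    then have "y \<in> verts G" using assms(1) by (auto simp: simple_graph_def)
    then obtain z where "{z, y} \<in> edges G" "graph_dist G x z = k"
      using graph_dist_pred[OF assms(2,3) _ y(2)] by metis
    then have "{z, y} \<in> edge_layer G x k" using y by (auto simp: edge_layer_def)
    then show ?thesis by (rule bexI[rotated]) (use y(1) in auto)
  qed
  then have "edge_layer G x (Suc k) \<subseteq> (\<Union>f\<in>edge_layer G x k. N f)"
    unfolding N_def by blast
  then have "card (edge_layer G x (Suc k)) \<le> card (\<Union>f\<in>edge_layer G x k. N f)"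
    by (rule card_mono[rotated]) (simp add: finite_edge_layer[OF assms(1)] N_def)
  also have "\<dots> \<le> (\<Sum>f\<in>edge_layer G x k. card (N f))"
    by (rule card_UN_le[OF finite_edge_layer[OF assms(1)]])
  also have "\<dots> \<le> (\<Sum>f\<in>edge_layer G x k. max_degree G - 1)"
  proof (rule sum_mono)
    fix f assume f: "f \<in> edge_layer G x k"
    then obtain z where z: "z \<in> f" "graph_dist G x z = k" "f \<in> edges G"
      by (auto simp: edge_layer_def)
    then obtain y where y: "f = {z, y}" "y \<in> verts G"
      using simple_graph_edgeE[OF assms(1)] by metis
    \<comment> \<open>No edge of layer \<open>k + 1\<close> contains \<open>z\<close>, which has
      distance \<open>k\<close>. Hence edges of \<open>N f\<close> meet \<open>f\<close> in
      \<open>y\<close>, and \<open>f\<close> itself is not among them.\<close>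
    have "N f \<subseteq> incident G y - {f}"
      using y z by (auto simp: N_def incident_def edge_layer_def)
    then have "card (N f) \<le> card (incident G y - {f})"
      using finite_incident[OF assms(1)] by (intro card_mono) auto
    also have "\<dots> = degree G y - 1"
      using y z by (simp add: degree_def incident_def)
    finally show "card (N f) \<le> max_degree G - 1"
      using degree_le_max_degree[OF assms(1) y(2)] by simp
  qed
  finally show ?thesis by simp
qed

lemma card_edge_layer:
  assumes "simple_graph G" "connected_graph G" "x \<in> verts G"
  shows "card (edge_layer G x k) \<le> max_degree G * (max_degree G - 1) ^ k"
proof (induction k)
  case 0
  then show ?case using card_edge_layer_0[OF assms] by simp
next
  case (Suc k)
  have "card (edge_layer G x (Suc k)) \<le> card (edge_layer G x k) * (max_degree G - 1)"
    by (rule card_edge_layer_Suc[OF assms])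
  also have "\<dots> \<le> max_degree G * (max_degree G - 1) ^ k * (max_degree G - 1)"
    using Suc by (rule mult_le_mono1)
  finally show ?case by (simp add: ac_simps)
qed

text \<open>Each edge lies in the layer of its nearer end, whose index is at most the diameter. The
  bound is applied to maximum degree 1 and 2, where it does not grow exponentially.\<close>

lemma card_edges_le_Moore_bound:
  assumes "simple_graph G" "connected_graph G"
  shows "card (edges G) \<le> (\<Sum>k\<le>diam G. max_degree G * (max_degree G - 1) ^ k)"
proof -
  obtain x where x: "x \<in> verts G" using assms(2) by (auto simp: connected_graph_def)
  have "edges G \<subseteq> (\<Union>k\<in>{..diam G}. edge_layer G x k)"
  proof
    fix e assume e: "e \<in> edges G"
    then have sub: "e \<subseteq> verts G" and "card e = 2" using assms(1) by (auto simp: simple_graph_def)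
    then have fin: "finite e" "e \<noteq> {}" by (auto intro: card_ge_0_finite)
    define k where "k = Min (graph_dist G x ` e)"
    have "k \<in> graph_dist G x ` e" unfolding k_def using fin by (intro Min_in) auto
    then obtain v where v: "v \<in> e" "graph_dist G x v = k" by auto
    have "\<forall>v\<in>e. k \<le> graph_dist G x v" unfolding k_def using fin by auto
    moreover have "k \<le> diam G" using graph_dist_le_diam[OF assms(1) x] v sub by auto
    ultimately show "e \<in> (\<Union>k\<in>{..diam G}. edge_layer G x k)"
      using e v by (auto simp: edge_layer_def)
  qed
  then have "card (edges G) \<le> card (\<Union>k\<in>{..diam G}. edge_layer G x k)"
    by (rule card_mono[rotated]) (simp add: finite_edge_layer[OF assms(1)])
  also have "\<dots> \<le> (\<Sum>k\<le>diam G. card (edge_layer G x k))" by (rule card_UN_le) simp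
  also have "\<dots> \<le> (\<Sum>k\<le>diam G. max_degree G * (max_degree G - 1) ^ k)"
    by (rule sum_mono) (rule card_edge_layer[OF assms x])
  finally show ?thesis .
qed

section \<open>Cyclic distance of colors\<close>

text \<open>Cyclic distance at most \<open>m\<close> modulo \<open>t\<close>, encoded by a signed
  displacement \<open>j\<close> so that displacements simply add along a path.\<close>

definition near :: "nat \<Rightarrow> nat \<Rightarrow> nat \<Rightarrow> nat \<Rightarrow> bool" where
  "near t m a b \<longleftrightarrow> (\<exists>j. \<bar>j\<bar> \<le> int m \<and> int t dvd int b - int a - j)"

lemma near_trans:
  assumes "near t m a b" "near t n b c"
  shows "near t (m + n) a c"
proof -
  obtain i j where "\<bar>i\<bar> \<le> int m" "int t dvd int b - int a - i"
    "\<bar>j\<bar> \<le> int n" "int t dvd int c - int b - j"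
    using assms unfolding near_def by blast
  note ij = this
  have "int c - int a - (i + j) = (int b - int a - i) + (int c - int b - j)" by simp
  then have "int t dvd int c - int a - (i + j)" using ij by (metis dvd_add)
  moreover have "\<bar>i + j\<bar> \<le> int (m + n)" using ij by simp
  ultimately show ?thesis unfolding near_def by blast
qed

lemma near_mono: "near t m a b \<Longrightarrow> m \<le> n \<Longrightarrow> near t n a b"
  unfolding near_def by (meson order_trans of_nat_le_iff)

text \<open>Two colors cut the color cycle into two closed arcs, and a cyclic interval through both
  contains one of these arcs entirely. That arc has at most \<open>m + 1\<close> colors, hence at
  most \<open>m\<close> steps.\<close>

lemma cyclic_interval_near:
  assumes A: "cyclic_interval t A" and a: "a \<in> A" and b: "b \<in> A" and card: "card A \<le> Suc m"
  shows "near t m a b"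
proof -
  have sub: "A \<subseteq> {1..t}" using A by (simp add: cyclic_interval_def)
  have fin: "finite A" using sub finite_subset by blast
  have ivl: "near t m x y" if "x \<le> y" "{x..y} \<subseteq> A \<or> {1..x} \<union> {y..t} \<subseteq> A"
    "x \<in> A" "y \<in> A" for x y
  proof (cases "{x..y} \<subseteq> A")
    case True
    then have "card {x..y} \<le> card A" using fin by (rule card_mono[rotated])
    then show ?thesis using card that unfolding near_def
      by (intro exI[of _ "int y - int x"]) auto
  next
    case False
    then have *: "{1..x} \<union> {y..t} \<subseteq> A" "x < y" using that by (auto simp: le_less)
    then have "card ({1..x} \<union> {y..t}) \<le> card A" using fin by (intro card_mono)
    moreover have "card ({1..x} \<union> {y..t}) = x + (Suc t - y)"
      using * by (subst card_Un_disjoint) auto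
    ultimately have "x + t - y \<le> m" "y \<le> t" using card that sub by auto
    \<comment> \<open>The displacement is negative: it runs from \<open>x\<close> down to 1 and then
      from \<open>t\<close> down to \<open>y\<close>.\<close>
    then show ?thesis unfolding near_def
      by (intro exI[of _ "int y - int x - int t"]) auto
  qed
  have sym: "near t m x y" if yx: "near t m y x" for x y
  proof -
    obtain j where "\<bar>j\<bar> \<le> int m" "int t dvd int x - int y - j"
      using yx unfolding near_def by blast
    moreover have "int y - int x - (- j) = - (int x - int y - j)" by simp
    ultimately show ?thesis unfolding near_def
      by (intro exI[of _ "- j"]) (metis abs_minus_cancel dvd_minus_iff)
  qed
  have main: "near t m x y" if "x \<le> y" "x \<in> A" "y \<in> A" for x y
  proof (rule ivl[OF that(1) _ that(2,3)], cases "int_interval A")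
    case True
    then show "{x..y} \<subseteq> A \<or> {1..x} \<union> {y..t} \<subseteq> A" using that by (auto simp: int_interval_def)
  next
    case False
    then obtain l r where "{1..t} - A = {l..r}"
      using A by (auto simp: cyclic_interval_def int_interval_def)
    then have iff: "v \<in> A \<longleftrightarrow> \<not> (l \<le> v \<and> v \<le> r)" if "v \<in> {1..t}" for v
      using that by (metis DiffD2 DiffI atLeastAtMost_iff)
    have "x \<in> {1..t}" "y \<in> {1..t}" using that sub by auto
    then show "{x..y} \<subseteq> A \<or> {1..x} \<union> {y..t} \<subseteq> A"
      \<comment> \<open>The missing colors form one gap. If it lies above \<open>y\<close> or below
        \<open>x\<close>, the inner arc is in \<open>A\<close>; otherwise, as it avoids
        \<open>x\<close> and \<open>y\<close>, it can only lie between them, and the outer arc is in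
        \<open>A\<close>.\<close>
      using iff[of x] iff[of y] that by (cases "y < l \<or> r < x") (auto simp: iff)
  qed
  show ?thesis
    using main[of a b] main[of b a] sym a b by (cases "a \<le> b") auto
qed

text \<open>Sending a color to its displacement from \<open>a\<close> is injective, because two
  colors in \<open>{1..t}\<close> that are congruent modulo \<open>t\<close> are equal. Only
  \<open>2 * m + 1\<close> displacements are available.\<close>

lemma card_near_le:
  assumes "C \<subseteq> {1..t}" "\<And>b. b \<in> C \<Longrightarrow> near t m a b"
  shows "card C \<le> 2 * m + 1"
proof -
  have "\<forall>b\<in>C. \<exists>j. \<bar>j\<bar> \<le> int m \<and> int t dvd int b - int a - j"
    using assms(2) by (simp add: near_def)
  then obtain j where j: "\<And>b. b \<in> C \<Longrightarrow> \<bar>j b\<bar> \<le> int m \<and> int t dvd int b - int a - j b"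
    by (auto simp: bchoice_iff)
  have "inj_on j C"
  proof (rule inj_onI)
    fix b c assume bc: "b \<in> C" "c \<in> C" "j b = j c"
    then have "int t dvd (int b - int a - j b) - (int c - int a - j c)"
      using j by (blast intro: dvd_diff)
    then have "int t dvd int b - int c" using bc(3) by simp
    moreover have "b \<in> {1..t}" "c \<in> {1..t}" using bc(1,2) assms(1) by auto
    then have "\<bar>int b - int c\<bar> < int t" by auto
    ultimately show "b = c" using zdvd_imp_le[of "int t" "\<bar>int b - int c\<bar>"] by force
  qed
  then have "card C = card (j ` C)" by (simp add: card_image)
  also have "\<dots> \<le> card {- int m..int m}"
    by (rule card_mono) (use j in \<open>auto simp: abs_le_iff, smt (verit)\<close>)
  finally show ?thesis by simp
qed

section \<open>Colorings with pendant edges\<close>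

lemma card_incident_attach_pendants:
  assumes "simple_graph H" "v \<in> verts H"
  shows "card (incident (attach_pendants H p) (Inl v)) \<le> degree H v + p v"
    and "finite (incident (attach_pendants H p) (Inl v))"
proof -
  have inc: "incident (attach_pendants H p) (Inl v) =
      (`) Inl ` incident H v \<union> (\<lambda>i. {Inl v, Inr (v, i)}) ` {..<p v}"
    using assms(2) by (auto simp: incident_def attach_pendants_def)
  show "finite (incident (attach_pendants H p) (Inl v))"
    unfolding inc using finite_incident[OF assms(1)] by simp
  show "card (incident (attach_pendants H p) (Inl v)) \<le> degree H v + p v"
    unfolding inc degree_def
    by (rule order_trans[OF card_Un_le add_mono[OF card_image_le order_trans[OF card_image_le]]])
      (use finite_incident[OF assms(1)] in auto)
qed

lemma near_at_vertex:
  assumes "simple_graph H" "cyclic_interval_coloring (attach_pendants H p) t \<alpha>"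
    and "v \<in> verts H" "e \<in> edges H" "f \<in> edges H" "v \<in> e" "v \<in> f"
    and "degree H v + p v \<le> Suc m"
  shows "near t m (\<alpha> (Inl ` e)) (\<alpha> (Inl ` f))"
proof (rule cyclic_interval_near)
  let ?I = "incident (attach_pendants H p) (Inl v)"
  show "cyclic_interval t (\<alpha> ` ?I)"
    using assms(2,3) by (simp add: cyclic_interval_coloring_def attach_pendants_def)
  show "\<alpha> (Inl ` e) \<in> \<alpha> ` ?I" "\<alpha> (Inl ` f) \<in> \<alpha> ` ?I"
    using assms(4-7) by (auto simp: incident_def attach_pendants_def)
  have "card (\<alpha> ` ?I) \<le> card ?I"
    by (rule card_image_le) (rule card_incident_attach_pendants[OF assms(1,3)])
  also have "\<dots> \<le> degree H v + p v" by (rule card_incident_attach_pendants[OF assms(1,3)])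
  finally show "card (\<alpha> ` ?I) \<le> Suc m" using assms(8) by simp
qed

section \<open>Degrees in the hat graph and the spread of the colors at the apex\<close>

lemma degree_hat_Orig:
  assumes "simple_graph G"
  shows "degree (hat G) (Orig v) \<le> degree G v"
proof -
  have "incident (hat G) (Orig v) \<subseteq> (\<lambda>e. {Orig v, Mid e}) ` incident G v"
    by (auto simp: incident_def hat_def subdivision_def)
  then show ?thesis unfolding degree_def
    using finite_incident[OF assms] by (rule surj_card_le[rotated])
qed

text \<open>The neighbours are the two ends of \<open>e\<close> and the apex. This 3 is why maximum
  degree at most 2 is treated separately.\<close>

lemma degree_hat_Mid:
  assumes "simple_graph G" "e \<in> edges G"
  shows "degree (hat G) (Mid e) \<le> 3"
proof -
  have "card e = 2" using assms by (simp add: simple_graph_def)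
  then have fin: "finite e" by (auto intro: card_ge_0_finite)
  have "incident (hat G) (Mid e) \<subseteq> (\<lambda>v. {v, Mid e}) ` insert Apex (Orig ` e)"
    by (auto simp: incident_def hat_def subdivision_def)
  then have "degree (hat G) (Mid e) \<le> card (insert Apex (Orig ` e))" unfolding degree_def
    by (rule surj_card_le[rotated]) (use fin in simp)
  also have "\<dots> \<le> Suc (card (Orig ` e))" by (rule card_insert_le_m1) simp_all
  also have "\<dots> \<le> Suc (card e)" using card_image_le[OF fin] by simp
  finally show ?thesis using \<open>card e = 2\<close> by simp
qed

lemma card_edges_le_cyclic_deficiency:
  assumes G: "simple_graph G" and conn: "connected_graph G" and deg: "3 \<le> max_degree G"
  defines "m \<equiv> cyclic_deficiency (hat G) + max_degree G - 1"
  shows "card (edges G) \<le> 2 * ((2 * diam G + 3) * m) + 1"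
proof (cases "edges G = {}")
  case False
  have H: "simple_graph (hat G)" by (rule simple_graph_hat[OF G])
  obtain p t \<alpha> where p: "(\<Sum>v\<in>verts (hat G). p v) = cyclic_deficiency (hat G)"
    and col: "cyclic_interval_coloring (attach_pendants (hat G) p) t \<alpha>"
    using cyclic_deficiency_attained[OF H] by (auto simp: cyclically_interval_colorable_def)
  \<comment> \<open>All pendant edges might sit at a single vertex, so the whole deficiency is
    allowed for at each one.\<close>
  have p_le: "p v \<le> cyclic_deficiency (hat G)" if "v \<in> verts (hat G)" for v
    unfolding p[symmetric] by (rule member_le_sum[OF that]) (use H in \<open>auto simp: simple_graph_def\<close>)
  \<comment> \<open>\<open>\<beta> v e\<close> is the color of the half of \<open>e\<close> at its
    end \<open>v\<close>, and \<open>\<gamma> e\<close> the color of the edge from the apex to the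
    midpoint of \<open>e\<close>.\<close>
  define \<beta> where "\<beta> v e = \<alpha> (Inl ` {Orig v, Mid e})" for v e
  define \<gamma> where "\<gamma> e = \<alpha> (Inl ` {Apex, Mid e})" for e
  have near_Orig: "near t m (\<beta> v e) (\<beta> v f)"
    if "e \<in> edges G" "f \<in> edges G" "v \<in> e" "v \<in> f" for v e f
  proof -
    have v: "v \<in> verts G" using G that by (auto simp: simple_graph_def)
    then have v': "Orig v \<in> verts (hat G)" by (simp add: hat_def subdivision_def)
    have "degree (hat G) (Orig v) + p (Orig v) \<le> Suc m"
      using degree_hat_Orig[OF G, of v] degree_le_max_degree[OF G v] p_le[OF v']
      unfolding m_def by simp
    with v' show ?thesis unfolding \<beta>_def using that
      by (intro near_at_vertex[OF H col, of "Orig v"]) (auto simp: hat_def subdivision_def)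
  qed
  have near_Mid: "near t m (\<alpha> (Inl ` {a, Mid e})) (\<alpha> (Inl ` {b, Mid e}))"
    if "e \<in> edges G" "a \<in> insert Apex (Orig ` e)" "b \<in> insert Apex (Orig ` e)" for e a b
  proof -
    have e: "Mid e \<in> verts (hat G)" using that by (simp add: hat_def subdivision_def)
    have "degree (hat G) (Mid e) + p (Mid e) \<le> Suc m"
      using degree_hat_Mid[OF G that(1)] p_le[OF e] deg unfolding m_def by simp
    with e show ?thesis using that
      by (intro near_at_vertex[OF H col, of "Mid e"]) (auto simp: hat_def subdivision_def)
  qed
  obtain e0 x where e0: "e0 \<in> edges G" "x \<in> e0"
    using False G unfolding simple_graph_def by (metis card_2_iff equals0I insertI1)
  then have x: "x \<in> verts G" using G by (auto simp: simple_graph_def)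
  \<comment> \<open>The factor counts the vertices passed: the midpoint of \<open>e0\<close> and
    \<open>x\<close> itself at the start, then one midpoint and one original vertex for each further
    step of distance.\<close>
  have far: "near t ((2 * k + 2) * m) (\<gamma> e0) (\<beta> y e)"
    if "e \<in> edges G" "y \<in> e" "graph_dist G x y = k" for e y k
    using that
  proof (induction k arbitrary: e y)
    case 0
    then have "y = x" using graph_dist_eq_0_iff[OF conn x] G by (auto simp: simple_graph_def)
    then have "near t (m + m) (\<gamma> e0) (\<beta> y e)"
      using near_trans[OF near_Mid[of e0 Apex "Orig x"] near_Orig[of e0 e x, unfolded \<beta>_def]] e0 0
      by (simp add: \<beta>_def \<gamma>_def)
    then show ?case by (simp add: mult_2)
  next
    case (Suc k)
    have "y \<in> verts G" using G Suc by (auto simp: simple_graph_def)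
    then obtain z where z: "{z, y} \<in> edges G" "graph_dist G x z = k"
      using graph_dist_pred[OF conn x _ Suc.prems(3)] by metis
    have "near t ((2 * k + 2) * m) (\<gamma> e0) (\<beta> z {z, y})" using Suc.IH z by blast
    moreover have "near t m (\<beta> z {z, y}) (\<beta> y {z, y})"
      unfolding \<beta>_def using z by (intro near_Mid) auto
    moreover have "near t m (\<beta> y {z, y}) (\<beta> y e)" using near_Orig z Suc.prems by simp
    ultimately have "near t ((2 * k + 2) * m + m + m) (\<gamma> e0) (\<beta> y e)" by (blast intro: near_trans)
    then show ?case by (simp add: algebra_simps)
  qed
  \<comment> \<open>One last turn at the midpoint of \<open>e\<close> leads back to an apex edge and
    raises \<open>2 * diam G + 2\<close> to \<open>2 * diam G + 3\<close>.\<close>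
  have near_\<gamma>: "near t ((2 * diam G + 3) * m) (\<gamma> e0) (\<gamma> e)" if e: "e \<in> edges G" for e
  proof -
    obtain y where y: "y \<in> e" "y \<in> verts G"
      using G e unfolding simple_graph_def by (metis card_2_iff insertI1 subsetD)
    have "near t m (\<beta> y e) (\<gamma> e)"
      unfolding \<beta>_def \<gamma>_def using e y by (intro near_Mid) auto
    with far[OF e y(1) refl] have "near t ((2 * graph_dist G x y + 2) * m + m) (\<gamma> e0) (\<gamma> e)"
      by (rule near_trans)
    moreover have "(2 * graph_dist G x y + 2) * m + m \<le> (2 * diam G + 3) * m"
      using graph_dist_le_diam[OF G x y(2)] mult_le_mono1[of "2 * graph_dist G x y + 3" "2 * diam G + 3" m]
      by (simp add: algebra_simps)
    ultimately show ?thesis by (rule near_mono)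
  qed
  have apex_edge: "Inl ` {Apex, Mid e} \<in> edges (attach_pendants (hat G) p)" if "e \<in> edges G" for e
  proof -
    have "{Apex, Mid e} \<in> edges (hat G)" using that by (auto simp: hat_def)
    then show ?thesis unfolding attach_pendants_def
      by (simp only: ugraph.select_convs) (rule UnI1, rule imageI)
  qed
  have proper: "proper_edge_coloring (attach_pendants (hat G) p) t \<alpha>"
    using col by (simp add: cyclic_interval_coloring_def)
  \<comment> \<open>The edges at the apex pairwise meet there, so their distinct colors count the
    edges of \<open>G\<close>.\<close>
  have "inj_on \<gamma> (edges G)"
  proof (rule inj_onI, rule ccontr)
    fix e f assume ef: "e \<in> edges G" "f \<in> edges G" "\<gamma> e = \<gamma> f" "e \<noteq> f"
    let ?h = "\<lambda>e. Inl ` {Apex, Mid e} :: ('a hat_vertex + 'a hat_vertex \<times> nat) set"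
    have "?h e \<noteq> ?h f" using ef(4) by (simp add: doubleton_eq_iff)
    moreover have "?h e \<inter> ?h f \<noteq> {}" by simp
    ultimately have "\<alpha> (?h e) \<noteq> \<alpha> (?h f)"
      using proper apex_edge[OF ef(1)] apex_edge[OF ef(2)]
      unfolding proper_edge_coloring_def by metis
    then show False using ef(3) by (simp only: \<gamma>_def)
  qed
  then have "card (edges G) = card (\<gamma> ` edges G)" by (simp add: card_image)
  also have "\<dots> \<le> 2 * ((2 * diam G + 3) * m) + 1"
  proof (rule card_near_le)
    show "\<gamma> ` edges G \<subseteq> {1..t}"
    proof (rule image_subsetI)
      fix e assume "e \<in> edges G"
      from apex_edge[OF this] show "\<gamma> e \<in> {1..t}"
        using proper unfolding proper_edge_coloring_def \<gamma>_def by (metis image_subset_iff)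
    qed
  qed (use near_\<gamma> in auto)
  finally show ?thesis .
qed simp

theorem theorem8:
  fixes G :: "'v ugraph"
  assumes "simple_graph G"
    and "connected_graph G"
    and "card (verts G) \<ge> 2"
  shows "real (cyclic_deficiency (hat G))
           \<ge> (real (card (edges G)) - 1) / (4 * (real (diam G) + 2)) - real (max_degree G) + 1"
proof -
  define m where "m = cyclic_deficiency (hat G) + max_degree G - 1"
  have \<Delta>: "max_degree G \<ge> 1" by (rule max_degree_pos[OF assms])
  have "card (edges G) \<le> 4 * (diam G + 2) * m + 1"
  proof -
    consider "max_degree G = 1" | "max_degree G = 2" | "max_degree G \<ge> 3" using \<Delta> by linarith
    then show ?thesis
    proof cases
      case 1
      \<comment> \<open>Only the term \<open>k = 0\<close> of the sum survives, so there is at most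
        one edge; this suffices even if \<open>m\<close> is 0.\<close>
      then show ?thesis using card_edges_le_Moore_bound[OF assms(1,2)]
        by (simp add: power_0_left)
    next
      case 2
      have "card (edges G) \<le> 2 * (diam G + 1)"
        using card_edges_le_Moore_bound[OF assms(1,2)] by (simp add: 2)
      also have "\<dots> \<le> 4 * (diam G + 2) * 1" by simp
      \<comment> \<open>Here \<open>m\<close> is the deficiency plus 1, hence positive.\<close>
      also have "\<dots> \<le> 4 * (diam G + 2) * m" by (rule mult_le_mono2) (simp add: m_def 2)
      finally show ?thesis by (rule trans_le_add1)
    next
      case 3
      \<comment> \<open>The factor \<open>4 * diam G + 6\<close> is rounded up to
        \<open>4 * diam G + 8\<close>.\<close>
      have "2 * ((2 * diam G + 3) * m) \<le> 4 * (diam G + 2) * m" by (simp add: algebra_simps)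
      then show ?thesis
        using card_edges_le_cyclic_deficiency[OF assms(1,2) 3] unfolding m_def by linarith
    qed
  qed
  then have "real (card (edges G)) \<le> real (4 * (diam G + 2) * m + 1)" by (simp only: of_nat_le_iff)
  then have "(real (card (edges G)) - 1) / (4 * (real (diam G) + 2)) \<le> real m"
    by (simp add: divide_le_eq algebra_simps)
  then show ?thesis using \<Delta> by (simp add: m_def of_nat_diff)
qed

end
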